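(* In the setting and notation of the context, suppose that: (1) (uniform convergence) uniform convergence holds over $\mathcal H$ for the losses $\ell_0$, $\ell$ and $\mathbb I\{\ell\le 0\}$ with rates $\zeta_0(N,\delta)$, $\zeta(N,\delta)$ and $\zeta_I(N,\delta)$; (2) (dual attainment) the statistical and empirical dual optimal solutions $\lambda^\star\in L^1_+(\mathcal D)$ and $\hat\lambda^\star\in\mathbb R_+^N$ exist; (3) (bounded multiplier) $\|\lambda^\star\|_\infty\le\gamma<\infty$; (4) the hypothesis class $\mathcal H$ is convex; (5) the constraint loss $\ell$ is convex and the objective loss $\ell_0$ is strongly convex (as functionals of the predictor). Let $\bar f_\theta=\arg\min_{f\in\mathcal H}\hat L(f,\hat\lambda^\star)$ be the estimator returned by the empirical dual problem. Then $\bar f_\theta$ is the same as the estimator returned by (i.e. the solution of) the empirical constrained problem $$\hat P^\star=\min_{f\in\mathcal H}\frac1N\sum_{n=1}^N\ell_0(f,\mathbf z^0_n)\quad\text{s.t.}\quad\ell(f,\mathbf z_n)\le0,\ n=1,\dots,N.$$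
   Context: Setting. $\mathcal X,\mathcal Y$ are the input and output spaces, $\mathcal Z=\mathcal X\times\mathcal Y$, $\mathbf z=(\mathbf x,y)$. $\mathcal D_0,\mathcal D$ are probability distributions on $\mathcal Z$. $\mathcal H=\{f_\theta:\theta\in\Theta\subseteq\mathbb R^p\}$ is a class of predictors $f_\theta:\mathcal X\to\mathcal Y$. The objective loss is $\ell_0:\mathcal Y\times\mathcal Y\to[0,B]$; the constraint loss is $\ell=\ell_1-c$ with $\ell_1:\mathcal Y\times\mathcal Y\to[0,B]$ and a threshold $c\in\mathbb R$. Write $\ell(f,\mathbf z)=\ell(f(\mathbf x),y)$, similarly for $\ell_0$. Convexity of $\ell$ (strong convexity of $\ell_0$) means that for every $\mathbf z$ the map $f\mapsto\ell(f,\mathbf z)$ is convex (resp. $f\mapsto\ell_0(f,\mathbf z)$ is strongly convex with respect to the norm of the predictor space). Minima over $\mathcal H$ are assumed attained wherever "min" or "argmin" is written. Samples. $S_0=\{\mathbf z^0_n\}_{n=1}^N$ is i.i.d. from $\mathcal D_0$ and $S=\{\mathbf z_n\}_{n=1}^N$ is i.i.d. from $\mathcal D$ (if $\mathcal D_0=\mathcal D$ one may take $S_0=S$). Uniform convergence. A loss $h$ satisfies uniform convergence over $\mathcal H$ with rate $\zeta_h(N,\delta)\ge 0$ (decreasing in $N$) if, for every distribution $\mathcal Q$ on $\mathcal Z$, with probability at least $1-\delta$ over $N$ i.i.d. samples $\mathbf z_n\sim\mathcal Q$, $\big|\mathbb E_{\mathcal Q}[h(f,\mathbf z)]-\frac1N\sum_n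 h(f,\mathbf z_n)\big|\le\zeta_h(N,\delta)$ for all $f\in\mathcal H$ simultaneously. Standing assumption: the rates come from vanishing Rademacher complexity, i.e. $\zeta_h(N,\delta)=2\mathcal R_N(h\circ\mathcal H)+B_h\sqrt{\log(2/\delta)/(2N)}$ with $\mathcal R_N(h\circ\mathcal H)=\frac1N\mathbb E_{S}\mathbb E_\sigma\big[\sup_{f\in\mathcal H}\sum_{n=1}^N\sigma_n h(f,\mathbf z_n)\big]\to0$, $\sigma_n$ i.i.d. uniform on $\{\pm1\}$, and $B_h=B$ for $\ell_0,\ell$ and $B_h=1$ for the indicator. Dual problems. For $\lambda\in L^1_+(\mathcal D)$ (nonnegative $\mathcal D$-integrable functions), $L(f,\lambda)=\mathbb E_{\mathcal D_0}[\ell_0(f,\mathbf z)]+\mathbb E_{\mathcal D}[\lambda(\mathbf z)\ell(f,\mathbf z)]$, $g(\lambda)=\min_{f\in\mathcal H}L(f,\lambda)$, and $\lambda^\star$ is a maximizer of $g$ over $L^1_+(\mathcal D)$. For $\lambda\in\mathbb R^N_+$, $\hat L(f,\lambda)=\frac1N\sum_{n}\ell_0(f,\mathbf z^0_n)+\frac1N\sum_{n}\lambda_n\ell(f,\mathbf z_n)$, $\hat g(\lambda)=\min_{f\in\mathcal H}\hat L(f,\lambda)$, and $\hat\lambda^\star$ is a maximizer of $\hat g$ over $\mathbb R^N_+$. $\|\cdot\|_\infty$ is the $L^\infty(\mathcal D)$ norm.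
   Formalization: The formal theorem additionally assumes that f ↦ ℓ(f,z) is continuous on H in the predictor norm for every z; without it the claim fails for convex losses that jump at the boundary of H. *)

theory Defs
  imports "HOL-Probability.Probability"
begin

(* Predictors are elements f of a normed space 'f; evl f :: 'x => 'y is the underlying function.
   Linearity and injectivity of evl make 'f a normed space of functions with pointwise operations.
   evl is allowed to take values outside the output space for f outside the hypothesis class. *)

definition normed_function_space :: "('f::real_normed_vector \<Rightarrow> 'x \<Rightarrow> 'y::real_vector) \<Rightarrow> bool" where
  "normed_function_space evl \<longleftrightarrow> (\<forall>x. linear (\<lambda>f. evl f x)) \<and> inj evl"

definition pred_loss ::
  "('f \<Rightarrow> 'x \<Rightarrow> 'y) \<Rightarrow> ('y \<Rightarrow> 'y \<Rightarrow> real) \<Rightarrow> 'f \<Rightarrow> 'x \<times> 'y \<Rightarrow> real" where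
  "pred_loss evl l f z = l (evl f (fst z)) (snd z)"

definition strongly_convex_on :: "'f::real_normed_vector set \<Rightarrow> ('f \<Rightarrow> real) \<Rightarrow> bool" where
  "strongly_convex_on S h \<longleftrightarrow> convex S \<and>
     (\<exists>\<kappa>>0. \<forall>f\<in>S. \<forall>g\<in>S. \<forall>u\<ge>0. \<forall>v\<ge>0. u + v = 1 \<longrightarrow>
        h (u *\<^sub>R f + v *\<^sub>R g) \<le> u * h f + v * h g - \<kappa> / 2 * u * v * (norm (f - g))\<^sup>2)"

definition distributions :: "'z measure \<Rightarrow> 'z measure set" where
  "distributions Z = {Q. prob_space Q \<and> sets Q = sets Z}"

definition (in prob_space) iid_sample ::
  "'z measure \<Rightarrow> 'z measure \<Rightarrow> nat \<Rightarrow> (nat \<Rightarrow> 'a \<Rightarrow> 'z) \<Rightarrow> bool" where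
  "iid_sample Z Q N X \<longleftrightarrow>
     indep_vars (\<lambda>_. Z) X {..<N} \<and> (\<forall>n<N. distr M Z (X n) = Q)"

(* The supremum over a possibly uncountable class need not be measurable, so the event in the
   sample space is required to contain a measurable set of probability at least 1 - \<delta>. *)

definition uniform_convergence ::
  "'z measure \<Rightarrow> 'f set \<Rightarrow> ('f \<Rightarrow> 'z \<Rightarrow> real) \<Rightarrow> (nat \<Rightarrow> real \<Rightarrow> real) \<Rightarrow> bool" where
  "uniform_convergence Z H h \<zeta> \<longleftrightarrow>
     (\<forall>N \<delta>. 0 < N \<and> 0 < \<delta> \<and> \<delta> < 1 \<longrightarrow> 0 \<le> \<zeta> N \<delta>) \<and>
     (\<forall>N N' \<delta>. 0 < N \<and> N \<le> N' \<and> 0 < \<delta> \<and> \<delta> < 1 \<longrightarrow> \<zeta> N' \<delta> \<le> \<zeta> N \<delta>) \<and>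
     (\<forall>Q\<in>distributions Z. \<forall>N \<delta>. 0 < N \<and> 0 < \<delta> \<and> \<delta> < 1 \<longrightarrow>
        (\<exists>A\<in>sets (Pi\<^sub>M {..<N} (\<lambda>_. Q)).
           measure (Pi\<^sub>M {..<N} (\<lambda>_. Q)) A \<ge> 1 - \<delta> \<and>
           (\<forall>S\<in>A. \<forall>f\<in>H.
              \<bar>(\<integral>z. h f z \<partial>Q) - (1 / real N) * (\<Sum>n<N. h f (S n))\<bar> \<le> \<zeta> N \<delta>)))"

(* The rate in uniform_convergence does not depend on Q; accordingly the complexity is
   taken in the worst case over the sampling distribution.  The average over the signs is
   nonnegative (it dominates the sign average for any single f), so ennreal truncates nothing. *)

definition rademacher :: "'z measure \<Rightarrow> 'f set \<Rightarrow> ('f \<Rightarrow> 'z \<Rightarrow> real) \<Rightarrow> nat \<Rightarrow> ennreal" where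
  "rademacher Z H h N =
     (SUP Q\<in>distributions Z. ennreal (1 / real N) *
        (\<integral>\<^sup>+ S. ennreal (measure_pmf.expectation (pmf_of_set ({..<N} \<rightarrow>\<^sub>E {-1, 1}))
           (\<lambda>\<sigma>. SUP f\<in>H. \<Sum>n<N. \<sigma> n * h f (S n))) \<partial>(Pi\<^sub>M {..<N} (\<lambda>_. Q))))"

definition rademacher_rate ::
  "'z measure \<Rightarrow> 'f set \<Rightarrow> ('f \<Rightarrow> 'z \<Rightarrow> real) \<Rightarrow> real \<Rightarrow> (nat \<Rightarrow> real \<Rightarrow> real) \<Rightarrow> bool" where
  "rademacher_rate Z H h b \<zeta> \<longleftrightarrow>
     (\<forall>N \<delta>. 0 < N \<and> 0 < \<delta> \<and> \<delta> < 1 \<longrightarrow>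
        \<zeta> N \<delta> = 2 * enn2real (rademacher Z H h N) + b * sqrt (ln (2 / \<delta>) / (2 * real N))) \<and>
     rademacher Z H h \<longlonglongrightarrow> 0"

definition L1_nonneg :: "'z measure \<Rightarrow> ('z \<Rightarrow> real) set" where
  "L1_nonneg D = {\<mu>. integrable D \<mu> \<and> (AE z in D. 0 \<le> \<mu> z)}"

definition lagrangian ::
  "'z measure \<Rightarrow> 'z measure \<Rightarrow> ('f \<Rightarrow> 'z \<Rightarrow> real) \<Rightarrow> ('f \<Rightarrow> 'z \<Rightarrow> real)
     \<Rightarrow> 'f \<Rightarrow> ('z \<Rightarrow> real) \<Rightarrow> real" where
  "lagrangian D0 D h0 h f \<mu> = (\<integral>z. h0 f z \<partial>D0) + (\<integral>z. \<mu> z * h f z \<partial>D)"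

(* The orthant \<real>\<^sup>N\<^sub>+: only the coordinates n < N of a multiplier are ever used. *)

definition nonneg_orthant :: "nat \<Rightarrow> (nat \<Rightarrow> real) set" where
  "nonneg_orthant N = {\<mu>. \<forall>n<N. 0 \<le> \<mu> n}"

definition empirical_risk :: "nat \<Rightarrow> (nat \<Rightarrow> 'z) \<Rightarrow> ('f \<Rightarrow> 'z \<Rightarrow> real) \<Rightarrow> 'f \<Rightarrow> real" where
  "empirical_risk N s0 h0 f = (1 / real N) * (\<Sum>n<N. h0 f (s0 n))"

definition empirical_lagrangian ::
  "nat \<Rightarrow> (nat \<Rightarrow> 'z) \<Rightarrow> (nat \<Rightarrow> 'z) \<Rightarrow> ('f \<Rightarrow> 'z \<Rightarrow> real) \<Rightarrow> ('f \<Rightarrow> 'z \<Rightarrow> real)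
     \<Rightarrow> 'f \<Rightarrow> (nat \<Rightarrow> real) \<Rightarrow> real" where
  "empirical_lagrangian N s0 s h0 h f \<mu> =
     empirical_risk N s0 h0 f + (1 / real N) * (\<Sum>n<N. \<mu> n * h f (s n))"

definition minimizer_over :: "'f set \<Rightarrow> ('f \<Rightarrow> real) \<Rightarrow> 'f \<Rightarrow> bool" where
  "minimizer_over H J f \<longleftrightarrow> is_arg_min J (\<lambda>f. f \<in> H) f"

definition maximizer_over :: "'l set \<Rightarrow> ('l \<Rightarrow> real) \<Rightarrow> 'l \<Rightarrow> bool" where
  "maximizer_over \<Lambda> g \<mu> \<longleftrightarrow> is_arg_max g (\<lambda>\<mu>. \<mu> \<in> \<Lambda>) \<mu>"

(* Used only where the infimum is attained, i.e. is a minimum. *)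

definition dual_function :: "'f set \<Rightarrow> ('f \<Rightarrow> 'l \<Rightarrow> real) \<Rightarrow> 'l \<Rightarrow> real" where
  "dual_function H L \<mu> = (INF f\<in>H. L f \<mu>)"

definition solves_empirical_problem ::
  "'f set \<Rightarrow> nat \<Rightarrow> (nat \<Rightarrow> 'z) \<Rightarrow> (nat \<Rightarrow> 'z) \<Rightarrow> ('f \<Rightarrow> 'z \<Rightarrow> real) \<Rightarrow> ('f \<Rightarrow> 'z \<Rightarrow> real)
     \<Rightarrow> 'f \<Rightarrow> bool" where
  "solves_empirical_problem H N s0 s h0 h f \<longleftrightarrow>
     minimizer_over {f \<in> H. \<forall>n<N. h f (s n) \<le> 0} (empirical_risk N s0 h0) f"

end

theory Submission
  imports Defs
begin

text \<open>
  The dual function is one-sidedly differentiable at the empirical optimum, without any constraint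
  qualification: strong convexity makes the minimizers of the Lagrangian converge to
  \<open>fbar\<close> as the multiplier is perturbed along a coordinate. Optimality of the multiplier then
  gives a nonpositive slope in every admissible direction. Increasing a coordinate yields primal
  feasibility of \<open>fbar\<close>, decreasing a positive one yields complementary slackness, and
  these identify \<open>fbar\<close> as the unique constrained minimizer.
\<close>

section \<open>Calculus of strongly convex functionals\<close>

lemma strongly_convex_on_imp_convex_on:
  assumes "strongly_convex_on S h"
  shows "convex_on S h"
proof -
  obtain \<kappa> where S: "convex S" and \<kappa>: "\<kappa> > 0"
    and h: "\<And>f g u v. \<lbrakk>f \<in> S; g \<in> S; u \<ge> 0; v \<ge> 0; u + v = 1\<rbrakk> \<Longrightarrow>
      h (u *\<^sub>R f + v *\<^sub>R g) \<le> u * h f + v * h g - \<kappa> / 2 * u * v * (norm (f - g))\<^sup>2"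
    using assms unfolding strongly_convex_on_def by blast
  have "h (u *\<^sub>R f + v *\<^sub>R g) \<le> u * h f + v * h g"
    if "f \<in> S" "g \<in> S" "u \<ge> 0" "v \<ge> 0" "u + v = 1" for f g u v
  proof -
    have "\<kappa> / 2 * u * v * (norm (f - g))\<^sup>2 \<ge> 0" using \<kappa> that by simp
    with h[OF that] show ?thesis by linarith
  qed
  with S show ?thesis unfolding convex_on_def by blast
qed

lemma strongly_convex_on_add_convex_on:
  assumes "strongly_convex_on S h" "convex_on S k"
  shows "strongly_convex_on S (\<lambda>f. h f + k f)"
proof -
  obtain \<kappa> where S: "convex S" and \<kappa>: "\<kappa> > 0"
    and h: "\<And>f g u v. \<lbrakk>f \<in> S; g \<in> S; u \<ge> 0; v \<ge> 0; u + v = 1\<rbrakk> \<Longrightarrow>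
      h (u *\<^sub>R f + v *\<^sub>R g) \<le> u * h f + v * h g - \<kappa> / 2 * u * v * (norm (f - g))\<^sup>2"
    using assms unfolding strongly_convex_on_def by blast
  have "h (u *\<^sub>R f + v *\<^sub>R g) + k (u *\<^sub>R f + v *\<^sub>R g)
      \<le> u * (h f + k f) + v * (h g + k g) - \<kappa> / 2 * u * v * (norm (f - g))\<^sup>2"
    if "f \<in> S" "g \<in> S" "u \<ge> 0" "v \<ge> 0" "u + v = 1" for f g u v
  proof -
    have "k (u *\<^sub>R f + v *\<^sub>R g) \<le> u * k f + v * k g"
      using assms(2) that unfolding convex_on_def by blast
    with h[OF that] show ?thesis by (simp add: algebra_simps)
  qed
  with S \<kappa> show ?thesis unfolding strongly_convex_on_def by blast
qed

lemma strongly_convex_on_cmult: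
  assumes "strongly_convex_on S h" "a > 0"
  shows "strongly_convex_on S (\<lambda>f. a * h f)"
proof -
  obtain \<kappa> where S: "convex S" and \<kappa>: "\<kappa> > 0"
    and h: "\<And>f g u v. \<lbrakk>f \<in> S; g \<in> S; u \<ge> 0; v \<ge> 0; u + v = 1\<rbrakk> \<Longrightarrow>
      h (u *\<^sub>R f + v *\<^sub>R g) \<le> u * h f + v * h g - \<kappa> / 2 * u * v * (norm (f - g))\<^sup>2"
    using assms unfolding strongly_convex_on_def by blast
  have "a * h (u *\<^sub>R f + v *\<^sub>R g)
      \<le> u * (a * h f) + v * (a * h g) - (a * \<kappa>) / 2 * u * v * (norm (f - g))\<^sup>2"
    if "f \<in> S" "g \<in> S" "u \<ge> 0" "v \<ge> 0" "u + v = 1" for f g u v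
    using mult_left_mono[OF h[OF that], of a] \<open>a > 0\<close> by (simp add: algebra_simps)
  moreover have "a * \<kappa> > 0" using \<kappa> \<open>a > 0\<close> by simp
  ultimately show ?thesis using S unfolding strongly_convex_on_def by blast
qed

lemma convex_on_sum_functions:
  fixes h :: "'i \<Rightarrow> 'f::real_vector \<Rightarrow> real"
  assumes "convex S" "\<And>i. i \<in> I \<Longrightarrow> convex_on S (h i)"
  shows "convex_on S (\<lambda>f. \<Sum>i\<in>I. h i f)"
  using assms by (induction I rule: infinite_finite_induct) (auto simp: convex_on_const)

section \<open>Minimizers, dual values and stability of minimizers\<close>

lemma minimizer_over_iff:
  "minimizer_over H J f \<longleftrightarrow> f \<in> H \<and> (\<forall>g\<in>H. J f \<le> J g)" for J :: "'f \<Rightarrow> real"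
  unfolding minimizer_over_def is_arg_min_linorder by blast

lemma maximizer_over_iff:
  "maximizer_over \<Lambda> G \<mu> \<longleftrightarrow> \<mu> \<in> \<Lambda> \<and> (\<forall>\<nu>\<in>\<Lambda>. G \<nu> \<le> G \<mu>)" for G :: "'l \<Rightarrow> real"
  unfolding maximizer_over_def is_arg_max_linorder by blast

lemma dual_function_eq:
  assumes "minimizer_over H (\<lambda>f. L f \<mu>) f"
  shows "dual_function H L \<mu> = L f \<mu>"
  using assms unfolding dual_function_def minimizer_over_iff
  by (intro cInf_eq_minimum) auto

text \<open>Compare \<open>f\<close> with the midpoint of \<open>f\<close> and \<open>g\<close>:
  minimality says the midpoint is no better than \<open>f\<close>, while strong convexity puts it
  below the average of the two values by \<kappa>/8 times the squared distance. Doubling gives the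
  constant \<kappa>/4; only its positivity matters later.\<close>

lemma strongly_convex_quadratic_growth:
  assumes "strongly_convex_on H J" "minimizer_over H J f"
  obtains \<kappa> where "\<kappa> > 0" "\<And>g. g \<in> H \<Longrightarrow> J f + \<kappa> * (norm (g - f))\<^sup>2 \<le> J g"
proof -
  obtain \<kappa> where H: "convex H" and \<kappa>: "\<kappa> > 0"
    and J: "\<And>f g u v. \<lbrakk>f \<in> H; g \<in> H; u \<ge> 0; v \<ge> 0; u + v = 1\<rbrakk> \<Longrightarrow>
      J (u *\<^sub>R f + v *\<^sub>R g) \<le> u * J f + v * J g - \<kappa> / 2 * u * v * (norm (f - g))\<^sup>2"
    using assms(1) unfolding strongly_convex_on_def by blast
  have f: "f \<in> H" "\<And>g. g \<in> H \<Longrightarrow> J f \<le> J g"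
    using assms(2) unfolding minimizer_over_iff by auto
  have "J f + \<kappa> / 4 * (norm (g - f))\<^sup>2 \<le> J g" if g: "g \<in> H" for g
  proof -
    have "(1/2) *\<^sub>R g + (1/2) *\<^sub>R f \<in> H"
      by (rule convexD[OF H g f(1)]) auto
    then have "J f \<le> J ((1/2) *\<^sub>R g + (1/2) *\<^sub>R f)" by (rule f(2))
    also have "\<dots> \<le> 1/2 * J g + 1/2 * J f - \<kappa> / 2 * (1/2) * (1/2) * (norm (g - f))\<^sup>2"
      by (rule J[OF g f(1)]) auto
    finally show ?thesis by simp
  qed
  with \<kappa> show ?thesis by (intro that[of "\<kappa> / 4"]) auto
qed

text \<open>Near-optimality of the perturbed points pulls against quadratic growth at
  \<open>f\<close>, so these points are within distance of order sqrt t from \<open>f\<close>. Hence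
  they converge to \<open>f\<close> without any compactness or completeness of \<open>H\<close>, and
  continuity transfers the sign of \<open>\<psi>\<close> to the limit. In the application
  \<open>\<psi>\<close> is the derivative of the Lagrangian along a direction in multiplier
  space.\<close>

lemma perturbation_slope_nonpos:
  assumes sc: "strongly_convex_on H J" and f: "minimizer_over H J f"
    and cont: "continuous_on H \<psi>" and lower: "\<And>g. g \<in> H \<Longrightarrow> - C \<le> \<psi> g"
    and T: "T > 0"
    and perturb: "\<And>t. \<lbrakk>0 < t; t \<le> T\<rbrakk> \<Longrightarrow> \<exists>g\<in>H. J g + t * \<psi> g \<le> J f"
  shows "\<psi> f \<le> 0"
proof -
  obtain \<kappa> where \<kappa>: "\<kappa> > 0" and growth: "\<And>g. g \<in> H \<Longrightarrow> J f + \<kappa> * (norm (g - f))\<^sup>2 \<le> J g"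
    using strongly_convex_quadratic_growth[OF sc f] by blast
  define t where "t k = T / real (Suc k)" for k
  have t: "0 < t k" "t k \<le> T" for k
    using T by (auto simp: t_def field_simps)
  obtain g where g: "\<And>k. g k \<in> H" "\<And>k. J (g k) + t k * \<psi> (g k) \<le> J f"
    using perturb[OF t] by metis
  \<comment> \<open>Growth and the perturbation inequality combine by eliminating
    \<open>J (g k)\<close>. This single bound yields both the sign of \<open>\<psi>\<close> at
    \<open>g k\<close> and, through the lower bound on \<open>\<psi>\<close>, the rate of
    convergence.\<close>
  have bound: "\<kappa> * (norm (g k - f))\<^sup>2 \<le> - (t k * \<psi> (g k))" for k
    using growth[OF g(1), of k] g(2)[of k] by linarith
  have nonpos: "\<psi> (g k) \<le> 0" for k
  proof -
    have "0 \<le> \<kappa> * (norm (g k - f))\<^sup>2" using \<kappa> by simp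
    with bound[of k] have "t k * \<psi> (g k) \<le> 0" by linarith
    with t(1)[of k] show ?thesis by (simp add: mult_le_0_iff)
  qed
  have upper: "(norm (g k - f))\<^sup>2 \<le> t k * (C / \<kappa>)" for k
  proof -
    have "- (t k * \<psi> (g k)) \<le> t k * C"
      using mult_left_mono[OF lower[OF g(1)], of "t k" k] t(1)[of k] by simp
    with bound[of k] have "\<kappa> * (norm (g k - f))\<^sup>2 \<le> t k * C" by linarith
    with \<kappa> show ?thesis by (simp add: field_simps)
  qed
  have "t \<longlonglongrightarrow> 0" unfolding t_def
    using LIMSEQ_Suc[OF lim_const_over_n[of T]] by simp
  then have "(\<lambda>k. t k * (C / \<kappa>)) \<longlonglongrightarrow> 0" by (rule tendsto_mult_left_zero)
  then have "(\<lambda>k. (norm (g k - f))\<^sup>2) \<longlonglongrightarrow> 0"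
    by (rule tendsto_sandwich[OF _ _ tendsto_const, rotated 2]) (use upper in auto)
  then have "(\<lambda>k. sqrt ((norm (g k - f))\<^sup>2)) \<longlonglongrightarrow> sqrt 0" by (rule tendsto_real_sqrt)
  then have "g \<longlonglongrightarrow> f" by (simp add: tendsto_norm_zero_iff LIM_zero_iff)
  moreover have "f \<in> H" using f unfolding minimizer_over_iff by simp
  ultimately have "(\<lambda>k. \<psi> (g k)) \<longlonglongrightarrow> \<psi> f"
    using g(1) by (intro continuous_on_tendsto_compose[OF cont]) auto
  with nonpos show ?thesis by (intro LIMSEQ_le_const2) auto
qed

section \<open>The empirical Lagrangian and its dual\<close>

lemma strongly_convex_on_empirical_lagrangian:
  assumes N: "0 < N" and \<mu>: "\<mu> \<in> nonneg_orthant N" and H: "convex H"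
    and h0: "\<And>n. n < N \<Longrightarrow> strongly_convex_on H (\<lambda>f. h0 f (s0 n))"
    and h: "\<And>n. n < N \<Longrightarrow> convex_on H (\<lambda>f. h f (s n))"
  shows "strongly_convex_on H (\<lambda>f. empirical_lagrangian N s0 s h0 h f \<mu>)"
proof -
  \<comment> \<open>The sample loss at index 0, which exists since \<open>N\<close> is positive,
    supplies the strong convexity; the other summands only have to be convex. This avoids a minimum
    of the moduli, which may differ between sample points.\<close>
  have "convex_on H (\<lambda>f. \<Sum>n\<in>{..<N} - {0}. h0 f (s0 n))"
    using H by (intro convex_on_sum_functions) (auto intro: strongly_convex_on_imp_convex_on[OF h0])
  then have "strongly_convex_on H (\<lambda>f. h0 f (s0 0) + (\<Sum>n\<in>{..<N} - {0}. h0 f (s0 n)))"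
    by (rule strongly_convex_on_add_convex_on[OF h0[OF N]])
  moreover have "h0 f (s0 0) + (\<Sum>n\<in>{..<N} - {0}. h0 f (s0 n)) = (\<Sum>n<N. h0 f (s0 n))" for f
    using N by (simp add: sum.remove)
  ultimately have "strongly_convex_on H (\<lambda>f. 1 / real N * (\<Sum>n<N. h0 f (s0 n)))"
    using N by (intro strongly_convex_on_cmult) auto
  moreover have "convex_on H (\<lambda>f. 1 / real N * (\<Sum>n<N. \<mu> n * h f (s n)))"
    using h \<mu> H by (intro convex_on_cmul convex_on_sum_functions) (auto simp: nonneg_orthant_def)
  ultimately show ?thesis
    unfolding empirical_lagrangian_def empirical_risk_def
    by (rule strongly_convex_on_add_convex_on)
qed

text \<open>The Lagrangian is affine in each multiplier, so a change of one coordinate is an exact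
  linear perturbation of the kind treated in \<open>perturbation_slope_nonpos\<close>.\<close>

lemma empirical_lagrangian_fun_upd:
  assumes "n < N"
  shows "empirical_lagrangian N s0 s h0 h f (\<mu>(n := \<mu> n + e))
    = empirical_lagrangian N s0 s h0 h f \<mu> + e * (h f (s n) / real N)"
proof -
  have "(\<Sum>i<N. (\<mu>(n := \<mu> n + e)) i * h f (s i))
      = (\<Sum>i<N. \<mu> i * h f (s i) + (if i = n then e * h f (s n) else 0))"
    by (intro sum.cong) (auto simp: algebra_simps)
  also have "\<dots> = (\<Sum>i<N. \<mu> i * h f (s i)) + e * h f (s n)"
    using assms by (simp add: sum.distrib)
  finally show ?thesis
    unfolding empirical_lagrangian_def by (simp add: add_divide_distrib)
qed

lemma empirical_dual_solution:
  fixes H :: "'f::real_normed_vector set" and h0 h :: "'f \<Rightarrow> 'z \<Rightarrow> real"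
    and s0 s :: "nat \<Rightarrow> 'z" and N :: nat
  defines "L \<equiv> empirical_lagrangian N s0 s h0 h"
  assumes N: "0 < N" and H: "convex H"
    and h0: "\<And>n. n < N \<Longrightarrow> strongly_convex_on H (\<lambda>f. h0 f (s0 n))"
    and h: "\<And>n. n < N \<Longrightarrow> convex_on H (\<lambda>f. h f (s n))"
    and cont: "\<And>n. n < N \<Longrightarrow> continuous_on H (\<lambda>f. h f (s n))"
    and bounded: "\<And>n f. \<lbrakk>n < N; f \<in> H\<rbrakk> \<Longrightarrow> \<bar>h f (s n)\<bar> \<le> C"
    and attained: "\<And>\<nu>. \<nu> \<in> nonneg_orthant N \<Longrightarrow> \<exists>f. minimizer_over H (\<lambda>f. L f \<nu>) f"
    and \<mu>: "maximizer_over (nonneg_orthant N) (dual_function H L) \<mu>"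
    and fbar: "minimizer_over H (\<lambda>f. L f \<mu>) fbar"
  shows "solves_empirical_problem H N s0 s h0 h f \<longleftrightarrow> f = fbar"
proof -
  have \<mu>_nonneg: "\<mu> \<in> nonneg_orthant N"
    and \<mu>_max: "\<And>\<nu>. \<nu> \<in> nonneg_orthant N \<Longrightarrow> dual_function H L \<nu> \<le> dual_function H L \<mu>"
    using \<mu> unfolding maximizer_over_iff by auto
  have fbar_H: "fbar \<in> H" and fbar_min: "\<And>g. g \<in> H \<Longrightarrow> L fbar \<mu> \<le> L g \<mu>"
    using fbar unfolding minimizer_over_iff by auto
  have sc: "strongly_convex_on H (\<lambda>f. L f \<mu>)"
    unfolding L_def
    by (rule strongly_convex_on_empirical_lagrangian[OF N \<mu>_nonneg H]) (auto intro: h0 h)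
  \<comment> \<open>The witness minimizes the Lagrangian at the shifted multiplier. Its value there
    is the shifted dual value, hence at most the optimal dual value \<open>L fbar \<mu>\<close>. The
    shift \<open>e\<close> may be negative as long as the coordinate stays nonnegative.\<close>
  have dual_step: "\<exists>g\<in>H. L g \<mu> + e * (h g (s n) / real N) \<le> L fbar \<mu>"
    if n: "n < N" and e: "0 \<le> \<mu> n + e" for n e
  proof -
    let ?\<nu> = "\<mu>(n := \<mu> n + e)"
    have \<nu>: "?\<nu> \<in> nonneg_orthant N"
      using \<mu>_nonneg e unfolding nonneg_orthant_def by simp
    obtain g where g: "minimizer_over H (\<lambda>f. L f ?\<nu>) g" using attained[OF \<nu>] by blast
    have "L g ?\<nu> \<le> L fbar \<mu>"
      using \<mu>_max[OF \<nu>]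
      unfolding dual_function_eq[of H L, OF g] dual_function_eq[of H L, OF fbar] .
    moreover have "g \<in> H" using g unfolding minimizer_over_iff by simp
    ultimately show ?thesis
      unfolding L_def empirical_lagrangian_fun_upd[OF n] by blast
  qed
  \<comment> \<open>The sign \<sigma> is the direction of motion along coordinate \<open>n\<close>,
    and \<open>T\<close> is a distance over which that motion stays in the orthant.\<close>
  have slope: "\<sigma> * h fbar (s n) \<le> 0"
    if n: "n < N" and T: "T > 0" and \<sigma>: "\<bar>\<sigma>\<bar> = 1"
      and dir: "\<And>t. \<lbrakk>0 < t; t \<le> T\<rbrakk> \<Longrightarrow> 0 \<le> \<mu> n + t * \<sigma>" for n T \<sigma>
  proof -
    have "\<sigma> * (h fbar (s n) / real N) \<le> 0"
    proof (rule perturbation_slope_nonpos[OF sc fbar _ _ T, where C = "C / real N"])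
      show "continuous_on H (\<lambda>f. \<sigma> * (h f (s n) / real N))"
        using cont[OF n] N by (intro continuous_intros) auto
      show "- (C / real N) \<le> \<sigma> * (h g (s n) / real N)" if "g \<in> H" for g
      proof -
        have "\<bar>\<sigma> * h g (s n)\<bar> \<le> C" using bounded[OF n that] \<sigma> by (simp add: abs_mult)
        then have "- C \<le> \<sigma> * h g (s n)" by linarith
        then have "- C / real N \<le> \<sigma> * h g (s n) / real N" by (rule divide_right_mono) simp
        then show ?thesis by simp
      qed
      show "\<exists>g\<in>H. L g \<mu> + t * (\<sigma> * (h g (s n) / real N)) \<le> L fbar \<mu>"
        if "0 < t" "t \<le> T" for t
        using dual_step[OF n dir[OF that]] by (simp add: mult.assoc)
    qed
    then show ?thesis using N by (simp add: divide_le_0_iff)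
  qed
  \<comment> \<open>Increasing a multiplier is always admissible, so any positive step length
    serves.\<close>
  have feasible: "h fbar (s n) \<le> 0" if n: "n < N" for n
    using slope[OF n, of 1 1] \<mu>_nonneg n unfolding nonneg_orthant_def by simp
  have slack: "\<mu> n * h fbar (s n) = 0" if n: "n < N" for n
  proof (cases "\<mu> n = 0")
    case False
    then have "\<mu> n > 0" using \<mu>_nonneg n unfolding nonneg_orthant_def by force
    \<comment> \<open>A positive coordinate may be decreased by up to \<open>\<mu> n\<close>, which
      gives the reverse inequality.\<close>
    then have "- 1 * h fbar (s n) \<le> 0" by (intro slope[OF n]) auto
    with feasible[OF n] show ?thesis by simp
  qed simp
  have L_fbar: "L fbar \<mu> = empirical_risk N s0 h0 fbar"
    unfolding L_def empirical_lagrangian_def by (simp add: slack del: mult_eq_0_iff)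
  \<comment> \<open>Weak duality: at feasible points the penalty term is nonpositive. With
    \<open>L_fbar\<close> it compares the risks of \<open>fbar\<close> and \<open>g\<close> through
    their Lagrangian values.\<close>
  have L_le: "L g \<mu> \<le> empirical_risk N s0 h0 g" if "\<forall>n<N. h g (s n) \<le> 0" for g
  proof -
    have "(\<Sum>n<N. \<mu> n * h g (s n)) \<le> 0"
      using that \<mu>_nonneg unfolding nonneg_orthant_def
      by (intro sum_nonpos) (auto simp: mult_le_0_iff)
    then show ?thesis
      unfolding L_def empirical_lagrangian_def by (simp add: divide_le_0_iff)
  qed
  show ?thesis
  proof
    assume "f = fbar"
    then show "solves_empirical_problem H N s0 s h0 h f"
      unfolding solves_empirical_problem_def minimizer_over_iff
      using fbar_H feasible L_fbar fbar_min L_le by force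
  next
    assume "solves_empirical_problem H N s0 s h0 h f"
    then have f: "f \<in> H" "\<forall>n<N. h f (s n) \<le> 0"
      "empirical_risk N s0 h0 f \<le> empirical_risk N s0 h0 fbar"
      unfolding solves_empirical_problem_def minimizer_over_iff using fbar_H feasible by auto
    \<comment> \<open>Uniqueness comes from growth of the Lagrangian around its minimizer: a
      feasible \<open>f\<close> of no larger risk satisfies
      \<open>L f \<mu> \<le> L fbar \<mu>\<close>, which leaves no room for a positive
      distance.\<close>
    obtain \<kappa> where \<kappa>: "\<kappa> > 0" "L fbar \<mu> + \<kappa> * (norm (f - fbar))\<^sup>2 \<le> L f \<mu>"
      using strongly_convex_quadratic_growth[OF sc fbar] f(1) by metis
    with L_le[OF f(2)] f(3) L_fbar have "\<kappa> * (norm (f - fbar))\<^sup>2 \<le> 0" by linarith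
    with \<kappa>(1) show "f = fbar" by (simp add: mult_le_0_iff)
  qed
qed

section \<open>Application to the observed sample\<close>

theorem proposition2:
  fixes MX :: "'x measure" and MY :: "'y::real_vector measure"
    and evl :: "'f::real_normed_vector \<Rightarrow> 'x \<Rightarrow> 'y"
    and \<Theta> :: "(real ^ 'p) set" and F :: "real ^ 'p \<Rightarrow> 'f"
    and l0 l1 :: "'y \<Rightarrow> 'y \<Rightarrow> real" and B c \<gamma> :: real
    and D0 D :: "('x \<times> 'y) measure"
    and M :: "'w measure" and Z0 Z :: "nat \<Rightarrow> 'w \<Rightarrow> 'x \<times> 'y" and \<omega> :: 'w and N :: nat
    and \<zeta>\<^sub>0 \<zeta> \<zeta>\<^sub>I :: "nat \<Rightarrow> real \<Rightarrow> real"
    and \<mu>s :: "'x \<times> 'y \<Rightarrow> real" and \<mu>e :: "nat \<Rightarrow> real" and fbar :: 'f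
  defines "MZ \<equiv> MX \<Otimes>\<^sub>M MY"
  defines "H \<equiv> F ` \<Theta>"
  defines "loss0 \<equiv> pred_loss evl l0"
  defines "loss \<equiv> pred_loss evl (\<lambda>u v. l1 u v - c)"
  defines "L \<equiv> lagrangian D0 D loss0 loss"
  defines "Le \<equiv> empirical_lagrangian N (\<lambda>n. Z0 n \<omega>) (\<lambda>n. Z n \<omega>) loss0 loss"
  assumes input_space: "space MX = UNIV"
    and predictor_space: "normed_function_space evl"
    and predictors: "\<And>f. f \<in> H \<Longrightarrow> evl f \<in> MX \<rightarrow>\<^sub>M MY"
    and loss_measurable:
      "case_prod l0 \<in> borel_measurable (MY \<Otimes>\<^sub>M MY)"
      "case_prod l1 \<in> borel_measurable (MY \<Otimes>\<^sub>M MY)"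
    and loss_range:
      "\<And>u v. u \<in> space MY \<Longrightarrow> v \<in> space MY \<Longrightarrow> l0 u v \<in> {0..B}"
      "\<And>u v. u \<in> space MY \<Longrightarrow> v \<in> space MY \<Longrightarrow> l1 u v \<in> {0..B}"
    and data_distributions: "D0 \<in> distributions MZ" "D \<in> distributions MZ"
    and sample_size: "0 < N"
    and sample_space: "prob_space M"
    and samples: "prob_space.iid_sample M MZ D0 N Z0" "prob_space.iid_sample M MZ D N Z"
    and outcome: "\<omega> \<in> space M"
    and uniform_conv:
      "uniform_convergence MZ H loss0 \<zeta>\<^sub>0"
      "uniform_convergence MZ H loss \<zeta>"
      "uniform_convergence MZ H (\<lambda>f z. of_bool (loss f z \<le> 0)) \<zeta>\<^sub>I"
    and rates:
      "rademacher_rate MZ H loss0 B \<zeta>\<^sub>0"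
      "rademacher_rate MZ H loss B \<zeta>"
      "rademacher_rate MZ H (\<lambda>f z. of_bool (loss f z \<le> 0)) 1 \<zeta>\<^sub>I"
    and minima_attained:
      "\<And>\<mu>. \<mu> \<in> L1_nonneg D \<Longrightarrow> \<exists>f. minimizer_over H (\<lambda>f. L f \<mu>) f"
      "\<And>\<mu>. \<mu> \<in> nonneg_orthant N \<Longrightarrow> \<exists>f. minimizer_over H (\<lambda>f. Le f \<mu>) f"
    and dual_attainment:
      "maximizer_over (L1_nonneg D) (dual_function H L) \<mu>s"
      "maximizer_over (nonneg_orthant N) (dual_function H Le) \<mu>e"
    and bounded_multiplier: "esssup D (\<lambda>z. ereal \<bar>\<mu>s z\<bar>) \<le> ereal \<gamma>"
    and convex_class: "convex H"
    and constraint_convex: "\<And>z. z \<in> space MZ \<Longrightarrow> convex_on H (\<lambda>f. loss f z)"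
    and constraint_continuous: "\<And>z. z \<in> space MZ \<Longrightarrow> continuous_on H (\<lambda>f. loss f z)"
    and objective_strongly_convex: "\<And>z. z \<in> space MZ \<Longrightarrow> strongly_convex_on H (\<lambda>f. loss0 f z)"
    and estimator: "minimizer_over H (\<lambda>f. Le f \<mu>e) fbar"
  shows "\<forall>f. solves_empirical_problem H N (\<lambda>n. Z0 n \<omega>) (\<lambda>n. Z n \<omega>) loss0 loss f \<longleftrightarrow> f = fbar"
proof -
  \<comment> \<open>Independence includes measurability of each sample variable, so the points lie
    in \<open>space MZ\<close> for every outcome and not just almost surely. The claim is therefore
    proved for each fixed \<open>\<omega>\<close>.\<close>
  have s0: "Z0 n \<omega> \<in> space MZ" and s: "Z n \<omega> \<in> space MZ" if "n < N" for n
    using samples that outcome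
    unfolding prob_space.iid_sample_def[OF sample_space] prob_space.indep_vars_def[OF sample_space]
    by (auto dest!: measurable_space)
  \<comment> \<open>Measurability of the predictor places its values in \<open>space MY\<close>,
    where the range of \<open>l1\<close> is known. The absolute value of \<open>B\<close> spares a
    separate proof that \<open>B\<close> is nonnegative.\<close>
  have bounded: "\<bar>loss f z\<bar> \<le> \<bar>B\<bar> + \<bar>c\<bar>" if "f \<in> H" "z \<in> space MZ" for f z
  proof -
    have "fst z \<in> space MX" "snd z \<in> space MY"
      using that(2) unfolding MZ_def by (auto simp: space_pair_measure)
    then have "l1 (evl f (fst z)) (snd z) \<in> {0..B}"
      using measurable_space[OF predictors[OF that(1)]] by (intro loss_range(2)) auto
    then show ?thesis unfolding loss_def pred_loss_def by auto
  qed
  show ?thesis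
    using sample_size convex_class objective_strongly_convex[OF s0] constraint_convex[OF s]
      constraint_continuous[OF s] bounded[OF _ s] minima_attained(2) dual_attainment(2) estimator
    unfolding Le_def by (intro allI empirical_dual_solution) auto
qed

end
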